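(* The hypergraph polynomials $T_{\mathrm{HG}}$, $Z_{\mathrm{P}}$ and $Z_{\mathrm{Grimmett}}$ are pairwise incomparable in distinguishing power, even among hypergraphs with the same global parameters, i.e. the same number of vertices, of components, of edges, and the same total degree. That is, for any two distinct $F_1,F_2\in\{T_{\mathrm{HG}},Z_{\mathrm{P}},Z_{\mathrm{Grimmett}}\}$ there exist hypergraphs $H,H'$ with $v(H)=v(H')$, $\kappa(H)=\kappa(H')$, $|E(H)|=|E(H')|$, $d(E(H))=d(E(H'))$ such that $F_1(H)=F_1(H')$ but $F_2(H)\ne F_2(H')$.
   Context: A hypergraph is a pair $H=(V,E)$ where $V$ is a finite set and $E=E(H)$ is a finite multiset (parallel hyperedges are allowed and treated as distinct elements of $E$) of multisets of elements of $V$, called hyperedges. For $e\in E$, $d(e)$ is the size of $e$ counted with multiplicity; it is always assumed that $d(e)>1$. Write $v(H)=|V|$. $\kappa(H)$ is the number of connected components of the bipartite incidence graph with vertex classes $V$ and $E$, in which $u\in V$ and $e\in E$ are joined by as many edges as the multiplicity of $u$ in $e$. For $A\subseteq E$ let $\kappa(A)=\kappa((V,A))$, $d(A)=\sum_{e\in A}d(e)$, and $|A|$ is the number of hyperedges in $A$. The polynomials are $T_{\mathrm{HG}}(H;x,y)=\sum_{A\subseteq E}(x-1)^{\kappa(A)-\kappa(H)}(y-1)^{d(A)-|A|-v(H)+\kappa(A)}$, $Z_{\mathrm{P}}(H;q,w)=\sum_{A\subseteq E}q^{\kappa(A)}\prod_{e\in A}(w^{d(e)-1}-1)$, $Z_{\mathrm{Grimmett}}(H;q,w)=\sum_{A\subseteq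 E}q^{\kappa(A)}(w-1)^{|A|}$. A hypergraph invariant $F_1$ is less distinguishing than $F_2$ if $F_2(H)=F_2(H')$ implies $F_1(H)=F_1(H')$ for all $H,H'$; $F_1,F_2$ are incomparable in distinguishing power if neither is less distinguishing than the other. *)

theory Defs
  imports "HOL-Library.Multiset" "HOL-Computational_Algebra.Polynomial"
begin

text \<open>
  The finite multiset of hyperedges is represented by a set of edge labels together with a map
  sending each label to the multiset of its vertices. Parallel hyperedges thus have distinct
  labels, and sub-collections of hyperedges are plain subsets of the label set.
\<close>

record ('v, 'e) pre_hypergraph =
  verts :: "'v set"
  edges :: "'e set"
  ends :: "'e \<Rightarrow> 'v multiset"

definition edge_deg :: "('v, 'e) pre_hypergraph \<Rightarrow> 'e \<Rightarrow> nat" where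
  "edge_deg H e = size (ends H e)"

definition hypergraph :: "('v, 'e) pre_hypergraph \<Rightarrow> bool" where
  "hypergraph H \<longleftrightarrow> finite (verts H) \<and> finite (edges H) \<and>
     (\<forall>e\<in>edges H. set_mset (ends H e) \<subseteq> verts H \<and> edge_deg H e > 1)"

definition total_deg :: "('v, 'e) pre_hypergraph \<Rightarrow> 'e set \<Rightarrow> nat" where
  "total_deg H A = (\<Sum>e\<in>A. edge_deg H e)"

text \<open>
  Adjacency in the bipartite incidence graph, whose node set is the disjoint union of vertices
  and hyperedges. The number of parallel incidence edges between \<open>u\<close> and \<open>e\<close> has no influence on
  the connected components, so only whether it is positive is recorded.
\<close>

definition incidence :: "('v, 'e) pre_hypergraph \<Rightarrow> ('v + 'e) rel" where
  "incidence H = {(Inl u, Inr e) |u e. u \<in> verts H \<and> e \<in> edges H \<and> u \<in># ends H e}"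

definition incidence_components :: "('v, 'e) pre_hypergraph \<Rightarrow> ('v + 'e) set set" where
  "incidence_components H =
     (verts H <+> edges H) // (incidence H \<union> (incidence H)\<inverse>)\<^sup>*"

definition \<kappa> :: "('v, 'e) pre_hypergraph \<Rightarrow> nat" where
  "\<kappa> H = card (incidence_components H)"

definition \<kappa>_on :: "('v, 'e) pre_hypergraph \<Rightarrow> 'e set \<Rightarrow> nat" where
  "\<kappa>_on H A = \<kappa> (H\<lparr>edges := A\<rparr>)"

text \<open>Bivariate integer polynomials are elements of \<open>int poly poly\<close>, i.e. of \<open>\<int>[X][Y]\<close>.\<close>

definition varX :: "int poly poly" where
  "varX = [:[:0, 1:]:]"

definition varY :: "int poly poly" where
  "varY = [:0, 1:]"

text \<open>
  The truncated subtractions in the exponents are exact for a hypergraph \<open>H\<close> and \<open>A \<subseteq> edges H\<close>: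
  adding a hyperedge \<open>e\<close> never increases the number of components and lowers it by at most
  \<open>edge_deg H e - 1\<close>, starting from \<open>\<kappa>_on H {} = card (verts H)\<close>.
\<close>

definition T_HG :: "('v, 'e) pre_hypergraph \<Rightarrow> int poly poly" where
  "T_HG H = (\<Sum>A\<in>Pow (edges H).
     (varX - 1) ^ (\<kappa>_on H A - \<kappa> H) *
     (varY - 1) ^ (total_deg H A + \<kappa>_on H A - (card A + card (verts H))))"

text \<open>In the two polynomials below, \<open>varX\<close> plays the role of \<open>q\<close> and \<open>varY\<close> that of \<open>w\<close>.\<close>

definition Z_P :: "('v, 'e) pre_hypergraph \<Rightarrow> int poly poly" where
  "Z_P H = (\<Sum>A\<in>Pow (edges H).
     varX ^ \<kappa>_on H A * (\<Prod>e\<in>A. varY ^ (edge_deg H e - 1) - 1))"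

definition Z_Grimmett :: "('v, 'e) pre_hypergraph \<Rightarrow> int poly poly" where
  "Z_Grimmett H = (\<Sum>A\<in>Pow (edges H). varX ^ \<kappa>_on H A * (varY - 1) ^ card A)"

definition less_distinguishing ::
  "(('v, 'e) pre_hypergraph \<Rightarrow> 'a) \<Rightarrow> (('v, 'e) pre_hypergraph \<Rightarrow> 'b) \<Rightarrow> bool" where
  "less_distinguishing F1 F2 \<longleftrightarrow>
     (\<forall>H H'. hypergraph H \<and> hypergraph H' \<and> F2 H = F2 H' \<longrightarrow> F1 H = F1 H')"

definition incomparable ::
  "(('v, 'e) pre_hypergraph \<Rightarrow> 'a) \<Rightarrow> (('v, 'e) pre_hypergraph \<Rightarrow> 'b) \<Rightarrow> bool" where
  "incomparable F1 F2 \<longleftrightarrow> \<not> less_distinguishing F1 F2 \<and> \<not> less_distinguishing F2 F1"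

end

theory Submission
  imports Defs
begin

text \<open>
  For each of the three polynomials there is a pair of small hypergraphs on which it agrees while
  the other two differ. With vertex sets \<open>{0,1}\<close>, \<open>{0,1}\<close> and \<open>{0,1,2}\<close> they are

    \<^item> \<open>{00, 011}\<close> and \<open>{000, 01}\<close> for Grimmett's polynomial, which ignores hyperedge sizes;
    \<^item> \<open>{000, 01, 01}\<close> and \<open>{00, 00, 011}\<close> for \<open>Z\<^sub>P\<close>, which on two vertices only sees the total
      of \<open>d(e) - 1\<close> over all hyperedges and over the loops;
    \<^item> \<open>{01, 01, 012}\<close> and \<open>{01, 02, 122}\<close> for \<open>T\<^sub>H\<^sub>G\<close>. Both have hyperedges of sizes
      \<open>2, 2, 3\<close>, so it suffices to compare the disconnected \<open>A\<close>; the generating functions by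
      \<open>d(A) - |A|\<close> of those supported on a given vertex pair, summed over the three pairs, agree:
      \<open>(1 + t)\<^sup>2 + 1 + 1 = (1 + t) + (1 + t) + (1 + t\<^sup>2)\<close>.
\<close>

section \<open>Counting components by labelling vertices\<close>

abbreviation connected_by :: "('v, 'e) pre_hypergraph \<Rightarrow> 'e set \<Rightarrow> ('v + 'e) rel" where
  "connected_by H A \<equiv> (incidence (H\<lparr>edges := A\<rparr>) \<union> (incidence (H\<lparr>edges := A\<rparr>))\<inverse>)\<^sup>*"

lemma connected_by_sym: "sym (connected_by H A)"
  by (intro sym_rtrancl sym_Un_converse)

lemma connected_by_commute: "(x, y) \<in> connected_by H A \<longleftrightarrow> (y, x) \<in> connected_by H A"
  using connected_by_sym by (metis symE)

lemma connected_by_mono: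
  assumes "A \<subseteq> B"
  shows "connected_by H A \<subseteq> connected_by H B"
  using assms by (intro rtrancl_mono) (auto simp: incidence_def)

lemma connected_by_vertex_edge:
  assumes "u \<in> verts H" "e \<in> A" "u \<in># ends H e"
  shows "(Inl u, Inr e) \<in> connected_by H A"
  using assms by (intro r_into_rtrancl) (auto simp: incidence_def)

text \<open>A certificate for the components of \<open>(V, A)\<close>: the second clause makes
  labels constant on each component. Labels are themselves vertices, so by the first clause a shared
  label witnesses connectedness.\<close>

definition component_labelling ::
  "('v, 'e) pre_hypergraph \<Rightarrow> 'e set \<Rightarrow> ('v \<Rightarrow> 'v) \<Rightarrow> bool" where
  "component_labelling H A f \<longleftrightarrow>
     (\<forall>v\<in>verts H. f v \<in> verts H \<and> (Inl v, Inl (f v)) \<in> connected_by H A) \<and>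
     (\<forall>e\<in>A. \<forall>u\<in>#ends H e. \<forall>v\<in>#ends H e. f u = f v)"

text \<open>Giving each hyperedge the label of one of its vertices makes the labelling invariant
  along every incidence, hence along paths.\<close>

lemma component_labelling_eq_if_connected:
  assumes f: "component_labelling H A f"
    and "(Inl u, Inl v) \<in> connected_by H A"
  shows "f u = f v"
proof -
  \<comment> \<open>For an empty hyperedge the choice is arbitrary, which is harmless because no
    vertex is incident to it.\<close>
  define F where "F = case_sum f (\<lambda>e. f (SOME w. w \<in># ends H e))"
  have incident: "F (Inl w) = F (Inr e)" if "e \<in> A" "w \<in># ends H e" for w e
  proof -
    have "(SOME w. w \<in># ends H e) \<in># ends H e"
      using that(2) by (rule someI)
    then have "f w = f (SOME w. w \<in># ends H e)"
      using f that unfolding component_labelling_def by blast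
    then show ?thesis
      by (simp add: F_def)
  qed
  have "F x = F y" if "(x, y) \<in> connected_by H A" for x y
    using that
  proof (induction rule: rtrancl_induct)
    case (step y z)
    then show ?case
      by (auto simp: incidence_def incident)
  qed simp
  from this[OF assms(2)] show ?thesis
    by (simp add: F_def)
qed

lemma component_labelling_eq_iff:
  assumes f: "component_labelling H A f" and uv: "u \<in> verts H" "v \<in> verts H"
  shows "f u = f v \<longleftrightarrow> (Inl u, Inl v) \<in> connected_by H A"
proof
  assume "f u = f v"
  with f uv have "(Inl u, Inl (f v)) \<in> connected_by H A" "(Inl (f v), Inl v) \<in> connected_by H A"
    unfolding component_labelling_def by (metis, metis connected_by_commute)
  then show "(Inl u, Inl v) \<in> connected_by H A"
    by (rule rtrancl_trans)
qed (rule component_labelling_eq_if_connected[OF f])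

text \<open>Sending a value of \<open>f\<close> to the value of \<open>g\<close> at any preimage is
  a bijection. This compares equivalence classes with labels, which live in different types.\<close>

lemma card_image_eq_if_same_kernel:
  assumes "\<And>u v. u \<in> V \<Longrightarrow> v \<in> V \<Longrightarrow> f u = f v \<longleftrightarrow> g u = g v"
  shows "card (f ` V) = card (g ` V)"
proof -
  have "bij_betw (\<lambda>y. g (inv_into V f y)) (f ` V) (g ` V)"
    unfolding bij_betw_def
  proof
    show "inj_on (\<lambda>y. g (inv_into V f y)) (f ` V)"
      by (rule inj_onI) (metis assms f_inv_into_f inv_into_into)
    have "g (inv_into V f (f v)) = g v" if "v \<in> V" for v
      using that by (metis assms f_inv_into_f inv_into_into imageI)
    then show "(\<lambda>y. g (inv_into V f y)) ` f ` V = g ` V"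
      by (force simp: image_image)
  qed
  then show ?thesis
    by (rule bij_betw_same_card)
qed

lemma edge_has_vertex:
  assumes "hypergraph H" "e \<in> edges H"
  obtains u where "u \<in># ends H e" "u \<in> verts H"
proof -
  have "ends H e \<noteq> {#}" "set_mset (ends H e) \<subseteq> verts H"
    using assms by (auto simp: hypergraph_def edge_deg_def)
  then show ?thesis
    using that by blast
qed

text \<open>Since \<open>d(e) > 1\<close>, every hyperedge shares its component with some vertex, so
  vertices represent all components, and two of them represent the same one iff their labels
  agree.\<close>

lemma \<kappa>_on_eq_card_labels:
  assumes H: "hypergraph H" and A: "A \<subseteq> edges H" and f: "component_labelling H A f"
  shows "\<kappa>_on H A = card (f ` verts H)"
proof -
  let ?R = "connected_by H A"
  have equiv: "equiv UNIV ?R"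
    using connected_by_sym by (intro equivI refl_rtrancl trans_rtrancl) auto
  have edge: "\<exists>u\<in>verts H. ?R `` {Inr e} = ?R `` {Inl u}" if e: "e \<in> A" for e
  proof -
    obtain u where u: "u \<in># ends H e" "u \<in> verts H"
      using edge_has_vertex[OF H] A e by blast
    with e have "(Inr e, Inl u) \<in> ?R"
      using connected_by_vertex_edge connected_by_commute by metis
    with u show ?thesis
      using equiv_class_eq[OF equiv] by blast
  qed
  have "(verts H <+> A) // ?R = (\<lambda>v. ?R `` {Inl v}) ` verts H"
  proof
    show "(verts H <+> A) // ?R \<subseteq> (\<lambda>v. ?R `` {Inl v}) ` verts H"
      using edge by (auto elim!: quotientE)
    show "(\<lambda>v. ?R `` {Inl v}) ` verts H \<subseteq> (verts H <+> A) // ?R"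
      by (auto intro!: quotientI)
  qed
  then have "\<kappa>_on H A = card ((\<lambda>v. ?R `` {Inl v}) ` verts H)"
    by (simp add: \<kappa>_on_def \<kappa>_def incidence_components_def)
  also have "\<dots> = card (f ` verts H)"
    by (rule card_image_eq_if_same_kernel)
      (simp add: component_labelling_eq_iff[OF f] eq_equiv_class_iff[OF equiv])
  finally show ?thesis .
qed

text \<open>A labelling computable by rewriting: starting from singletons, each hyperedge, the last
  of the list first, merges all labels it meets. \<open>Min\<close> fixes which label
  survives.\<close>

fun merged_label :: "('v::linorder, 'e) pre_hypergraph \<Rightarrow> 'e list \<Rightarrow> 'v \<Rightarrow> 'v" where
  "merged_label H [] = (\<lambda>v. v)"
| "merged_label H (e # es) =
     (\<lambda>v. if merged_label H es v \<in> merged_label H es ` set_mset (ends H e)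
          then Min (merged_label H es ` set_mset (ends H e)) else merged_label H es v)"

lemma component_labelling_merged_label:
  assumes H: "hypergraph H" and "set es \<subseteq> edges H"
  shows "component_labelling H (set es) (merged_label H es)"
  using assms(2)
proof (induction es)
  case Nil
  then show ?case
    by (simp add: component_labelling_def)
next
  case (Cons e es)
  let ?f = "merged_label H es" and ?R = "connected_by H (set (e # es))"
  let ?S = "?f ` set_mset (ends H e)"
  from Cons have f: "component_labelling H (set es) ?f" and e: "e \<in> edges H"
    by auto
  have sub: "set_mset (ends H e) \<subseteq> verts H"
    using H e by (auto simp: hypergraph_def)
  have f_conn: "?f v \<in> verts H \<and> (Inl v, Inl (?f v)) \<in> ?R" if "v \<in> verts H" for v
    using f that connected_by_mono[of "set es" "set (e # es)" H]
    unfolding component_labelling_def by auto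
  have "?S \<noteq> {}"
    using edge_has_vertex[OF H e] by blast
  then have "Min ?S \<in> ?S"
    by (intro Min_in) auto
  then obtain c where c: "c \<in># ends H e" "Min ?S = ?f c"
    by blast
  \<comment> \<open>The vertex \<open>?f u\<close> need not lie on \<open>e\<close>, but it is
    connected to \<open>u\<close>, which does.\<close>
  have to_edge: "(Inl (?f u), Inr e) \<in> ?R" if u: "u \<in># ends H e" for u
  proof -
    have "u \<in> verts H"
      using sub u by blast
    then have "(Inl u, Inl (?f u)) \<in> ?R" "(Inl u, Inr e) \<in> ?R"
      using f_conn connected_by_vertex_edge[OF _ _ u] by simp_all
    then show ?thesis
      using connected_by_commute rtrancl_trans by metis
  qed
  have conn: "(Inl v, Inl (?f c)) \<in> ?R" if v: "v \<in> verts H" "?f v \<in> ?S" for v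
  proof -
    from v obtain u where u: "u \<in># ends H e" "?f v = ?f u"
      by blast
    have "(Inl v, Inl (?f v)) \<in> ?R" "(Inl (?f v), Inr e) \<in> ?R" "(Inr e, Inl (?f c)) \<in> ?R"
      using f_conn[OF v(1)] to_edge[OF u(1)] to_edge[OF c(1)] u(2)
      by (auto simp only: connected_by_commute[of "Inr e"])
    then show ?thesis
      by (meson rtrancl_trans)
  qed
  show ?case
    unfolding component_labelling_def
  proof (intro conjI ballI)
    fix v assume v: "v \<in> verts H"
    show "merged_label H (e # es) v \<in> verts H"
      using f_conn v c sub by auto
    show "(Inl v, Inl (merged_label H (e # es) v)) \<in> ?R"
      using f_conn[OF v] conn[OF v] c(2) by simp
  next
    fix e' u v assume "e' \<in> set (e # es)" "u \<in># ends H e'" "v \<in># ends H e'"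
    \<comment> \<open>A new label depends only on the old one, so equalities from \<open>es\<close>
      persist; on \<open>e\<close> all labels become \<open>Min ?S\<close>.\<close>
    moreover have "?f u = ?f v" if "e' \<in> set es"
      using f that calculation unfolding component_labelling_def by blast
    ultimately show "merged_label H (e # es) u = merged_label H (e # es) v"
      by (cases "e' \<in> set es") simp_all
  qed
qed

section \<open>Evaluating the polynomials along a list of hyperedges\<close>

lemma sum_Pow_set_conv_subseqs:
  assumes "distinct es"
  shows "(\<Sum>A\<in>Pow (set es). g A) = (\<Sum>xs\<leftarrow>subseqs es. g (set xs))"
  using sum.distinct_set_conv_list[OF distinct_set_subseqs[OF assms], of g]
  by (simp add: subseqs_powset comp_def)

lemma subseqs_of_distinct:
  assumes "distinct es" "xs \<in> set (subseqs es)"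
  shows "distinct xs" "set xs \<subseteq> set es"
proof -
  show "distinct xs"
    using assms(2,1) by (rule subseqs_distinctD)
  show "set xs \<subseteq> set es"
    using assms(2) subseqs_powset[of es] by blast
qed

abbreviation num_labels :: "('v::linorder, 'e) pre_hypergraph \<Rightarrow> 'e list \<Rightarrow> nat" where
  "num_labels H es \<equiv> card (merged_label H es ` verts H)"

lemma \<kappa>_on_set:
  assumes "hypergraph H" "set es \<subseteq> edges H"
  shows "\<kappa>_on H (set es) = num_labels H es"
  using assms by (intro \<kappa>_on_eq_card_labels component_labelling_merged_label)

lemma \<kappa>_conv_num_labels:
  assumes "hypergraph H" "edges H = set es"
  shows "\<kappa> H = num_labels H es"
proof -
  have "H\<lparr>edges := edges H\<rparr> = H"
    by simp
  then show ?thesis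
    using \<kappa>_on_set[OF assms(1), of es] assms(2) by (metis \<kappa>_on_def order_refl)
qed

context
  fixes H :: "('v::linorder, 'e) pre_hypergraph" and es :: "'e list"
  assumes H: "hypergraph H" and es: "edges H = set es" "distinct es"
begin

text \<open>For explicit \<open>es\<close>, this and the next two lemmas give finite expressions
  that simplification can evaluate.\<close>

lemma T_HG_conv_subseqs:
  "T_HG H = (\<Sum>xs\<leftarrow>subseqs es.
     (varX - 1) ^ (num_labels H xs - num_labels H es) *
     (varY - 1) ^ ((\<Sum>e\<leftarrow>xs. edge_deg H e) + num_labels H xs - (length xs + card (verts H))))"
  unfolding T_HG_def es(1) sum_Pow_set_conv_subseqs[OF es(2)]
  by (rule arg_cong[where f = sum_list], rule map_cong[OF refl])
    (simp add: \<kappa>_on_set[OF H] \<kappa>_conv_num_labels[OF H es(1)] es(1) subseqs_of_distinct[OF es(2)]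
      total_deg_def distinct_card sum.distinct_set_conv_list)

lemma Z_P_conv_subseqs:
  "Z_P H = (\<Sum>xs\<leftarrow>subseqs es.
     varX ^ num_labels H xs * (\<Prod>e\<leftarrow>xs. varY ^ (edge_deg H e - 1) - 1))"
  unfolding Z_P_def es(1) sum_Pow_set_conv_subseqs[OF es(2)]
  by (rule arg_cong[where f = sum_list], rule map_cong[OF refl])
    (simp add: \<kappa>_on_set[OF H] es(1) subseqs_of_distinct[OF es(2)] prod.distinct_set_conv_list)

lemma Z_Grimmett_conv_subseqs:
  "Z_Grimmett H = (\<Sum>xs\<leftarrow>subseqs es. varX ^ num_labels H xs * (varY - 1) ^ length xs)"
  unfolding Z_Grimmett_def es(1) sum_Pow_set_conv_subseqs[OF es(2)]
  by (rule arg_cong[where f = sum_list], rule map_cong[OF refl])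
    (simp add: \<kappa>_on_set[OF H] es(1) subseqs_of_distinct[OF es(2)] distinct_card)

end

section \<open>The separating pairs\<close>

text \<open>Positions in the list serve as labels, so repeated entries are parallel
  hyperedges.\<close>

definition hypergraph_of :: "nat set \<Rightarrow> nat multiset list \<Rightarrow> (nat, nat) pre_hypergraph" where
  "hypergraph_of V Ms = \<lparr>verts = V, edges = {..<length Ms}, ends = (!) Ms\<rparr>"

lemma hypergraph_of_simps [simp]:
  "verts (hypergraph_of V Ms) = V"
  "edges (hypergraph_of V Ms) = {..<length Ms}"
  "ends (hypergraph_of V Ms) = (!) Ms"
  by (simp_all add: hypergraph_of_def)

lemma hypergraph_hypergraph_of:
  assumes "finite V" "\<forall>M\<in>set Ms. set_mset M \<subseteq> V \<and> size M > 1"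
  shows "hypergraph (hypergraph_of V Ms)"
  using assms by (auto simp: hypergraph_def edge_deg_def)

definition same_parameters :: "('v, 'e) pre_hypergraph \<Rightarrow> ('v, 'e) pre_hypergraph \<Rightarrow> bool" where
  "same_parameters H H' \<longleftrightarrow> hypergraph H \<and> hypergraph H' \<and>
     card (verts H) = card (verts H') \<and> \<kappa> H = \<kappa> H' \<and> card (edges H) = card (edges H') \<and>
     total_deg H (edges H) = total_deg H' (edges H')"

text \<open>The loops tell the pair apart: \<open>{00}\<close> contributes \<open>(x-1)(y-1)\<close>
  to \<open>T_HG\<close>, but \<open>{000}\<close> contributes \<open>(x-1)(y-1)^2\<close>; in
  \<open>Z_P\<close> their factors are \<open>w-1\<close> and \<open>w^2-1\<close>.\<close>

lemma Grimmett_pair: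
  defines "H \<equiv> hypergraph_of {0, 1} [{#0, 0#}, {#0, 1, 1#}]"
    and "H' \<equiv> hypergraph_of {0, 1} [{#0, 0, 0#}, {#0, 1#}]"
  shows "same_parameters H H'" "Z_Grimmett H = Z_Grimmett H'" "T_HG H \<noteq> T_HG H'" "Z_P H \<noteq> Z_P H'"
proof -
  have H: "hypergraph H" "edges H = set [0, 1]" "distinct [0, 1::nat]"
    and H': "hypergraph H'" "edges H' = set [0, 1]"
    by (simp_all add: H_def H'_def hypergraph_hypergraph_of lessThan_Suc insert_commute
      numeral_2_eq_2)
  note simps = H_def H'_def edge_deg_def card_insert_if
  show "same_parameters H H'"
    unfolding same_parameters_def \<kappa>_conv_num_labels[OF H(1,2)] \<kappa>_conv_num_labels[OF H']
    using H(1) H'(1) by (simp add: simps total_deg_def)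
  show "Z_Grimmett H = Z_Grimmett H'"
    unfolding Z_Grimmett_conv_subseqs[OF H] Z_Grimmett_conv_subseqs[OF H' H(3)]
    by (simp add: simps)
  show "T_HG H \<noteq> T_HG H'"
    unfolding T_HG_conv_subseqs[OF H] T_HG_conv_subseqs[OF H' H(3)]
    \<comment> \<open>The sums are evaluated with opaque variables first; unfolding these then
      reduces the claim to comparing coefficients.\<close>
    by (simp add: simps) (simp add: varX_def varY_def one_pCons numeral_poly)
  show "Z_P H \<noteq> Z_P H'"
    unfolding Z_P_conv_subseqs[OF H] Z_P_conv_subseqs[OF H' H(3)]
    by (simp add: simps) (simp add: varX_def varY_def one_pCons numeral_poly)
qed

text \<open>Only sets of loops leave two components, and summing the products over all subsets of a
  set gives \<open>w\<close> to its total of \<open>d(e)-1\<close>. So both \<open>Z_P\<close> equal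
  \<open>q w^4 + (q^2-q) w^2\<close>, whereas the number of loops, 1 against 2, shows in Grimmett's
  polynomial.\<close>

lemma Z_P_pair:
  defines "H \<equiv> hypergraph_of {0, 1} [{#0, 0, 0#}, {#0, 1#}, {#0, 1#}]"
    and "H' \<equiv> hypergraph_of {0, 1} [{#0, 0#}, {#0, 0#}, {#0, 1, 1#}]"
  shows "same_parameters H H'" "Z_P H = Z_P H'" "T_HG H \<noteq> T_HG H'" "Z_Grimmett H \<noteq> Z_Grimmett H'"
proof -
  have H: "hypergraph H" "edges H = set [0, 1, 2]" "distinct [0, 1, 2::nat]"
    and H': "hypergraph H'" "edges H' = set [0, 1, 2]"
    by (simp_all add: H_def H'_def hypergraph_hypergraph_of lessThan_Suc insert_commute
      numeral_2_eq_2)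
  note simps = H_def H'_def edge_deg_def card_insert_if
  show "same_parameters H H'"
    unfolding same_parameters_def \<kappa>_conv_num_labels[OF H(1,2)] \<kappa>_conv_num_labels[OF H']
    using H(1) H'(1) by (simp add: simps total_deg_def)
  show "Z_P H = Z_P H'"
    unfolding Z_P_conv_subseqs[OF H] Z_P_conv_subseqs[OF H' H(3)]
    by (simp add: simps algebra_simps)
  show "T_HG H \<noteq> T_HG H'"
    unfolding T_HG_conv_subseqs[OF H] T_HG_conv_subseqs[OF H' H(3)]
    by (simp add: simps) (simp add: varX_def varY_def one_pCons numeral_poly)
  show "Z_Grimmett H \<noteq> Z_Grimmett H'"
    unfolding Z_Grimmett_conv_subseqs[OF H] Z_Grimmett_conv_subseqs[OF H' H(3)]
    by (simp add: simps) (simp add: varX_def varY_def one_pCons numeral_poly)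
qed

text \<open>The sets \<open>{01, 01}\<close> and \<open>{122}\<close> match in \<open>T_HG\<close>,
  both having two components and \<open>d(A)-|A| = 2\<close>. They weigh \<open>(w-1)^2\<close>
  against \<open>w^2-1\<close> in \<open>Z_P\<close>, and \<open>(w-1)^2\<close> against
  \<open>w-1\<close> in Grimmett's polynomial.\<close>

lemma T_HG_pair:
  defines "H \<equiv> hypergraph_of {0, 1, 2} [{#0, 1#}, {#0, 1#}, {#0, 1, 2#}]"
    and "H' \<equiv> hypergraph_of {0, 1, 2} [{#0, 1#}, {#0, 2#}, {#1, 2, 2#}]"
  shows "same_parameters H H'" "T_HG H = T_HG H'" "Z_P H \<noteq> Z_P H'" "Z_Grimmett H \<noteq> Z_Grimmett H'"
proof -
  have H: "hypergraph H" "edges H = set [0, 1, 2]" "distinct [0, 1, 2::nat]"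
    and H': "hypergraph H'" "edges H' = set [0, 1, 2]"
    by (simp_all add: H_def H'_def hypergraph_hypergraph_of lessThan_Suc insert_commute
      numeral_2_eq_2)
  note simps = H_def H'_def edge_deg_def card_insert_if
  show "same_parameters H H'"
    unfolding same_parameters_def \<kappa>_conv_num_labels[OF H(1,2)] \<kappa>_conv_num_labels[OF H']
    using H(1) H'(1) by (simp add: simps total_deg_def)
  show "T_HG H = T_HG H'"
    unfolding T_HG_conv_subseqs[OF H] T_HG_conv_subseqs[OF H' H(3)]
    by (simp add: simps)
  show "Z_P H \<noteq> Z_P H'"
    unfolding Z_P_conv_subseqs[OF H] Z_P_conv_subseqs[OF H' H(3)]
    by (simp add: simps) (simp add: varX_def varY_def one_pCons numeral_poly)
  show "Z_Grimmett H \<noteq> Z_Grimmett H'"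
    unfolding Z_Grimmett_conv_subseqs[OF H] Z_Grimmett_conv_subseqs[OF H' H(3)]
    by (simp add: simps) (simp add: varX_def varY_def one_pCons numeral_poly)
qed

theorem theorem5p8:
  fixes T P G :: "(nat, nat) pre_hypergraph \<Rightarrow> int poly poly"
  defines "T \<equiv> T_HG" and "P \<equiv> Z_P" and "G \<equiv> Z_Grimmett"
  shows "incomparable T P \<and> incomparable T G \<and> incomparable P G \<and>
    (\<forall>(F1, F2) \<in> {(T, P), (P, T), (T, G), (G, T), (P, G), (G, P)}.
       \<exists>H H'. hypergraph H \<and> hypergraph H' \<and>
         card (verts H) = card (verts H') \<and> \<kappa> H = \<kappa> H' \<and>
         card (edges H) = card (edges H') \<and>
         total_deg H (edges H) = total_deg H' (edges H') \<and>
         F1 H = F1 H' \<and> F2 H \<noteq> F2 H')"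
proof -
  let ?separates = "\<lambda>F1 F2 :: (nat, nat) pre_hypergraph \<Rightarrow> int poly poly.
    \<exists>H H'. same_parameters H H' \<and> F1 H = F1 H' \<and> F2 H \<noteq> F2 H'"
  \<comment> \<open>Each pair serves twice: \<open>F1\<close> is the polynomial that agrees on it,
    \<open>F2\<close> either of the other two.\<close>
  have separates: "?separates T P" "?separates P T" "?separates T G" "?separates G T"
    "?separates P G" "?separates G P"
    unfolding T_def P_def G_def
    by ((intro exI conjI; rule T_HG_pair Z_P_pair Grimmett_pair)+)
  have not_less: "\<not> less_distinguishing F2 F1" if "?separates F1 F2" for F1 F2
    using that unfolding less_distinguishing_def same_parameters_def by blast
  show ?thesis
    using separates separates[THEN not_less]
    unfolding incomparable_def same_parameters_def by simp
qed

end
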